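(* Let $n\ge2$ be an integer, $k>0$, and let $\eta,p,q\in\mathbb{R}^n$ with $\eta,\ p,\ q-p\in(0,\infty)^n$, and $\zeta\in[0,\infty)^n$. Then for all $\phi,\psi\in(0,\infty)^n$, $$\left(\beta_{\zeta,k}^{(p,q)}(\phi+\psi;\eta)\right)^2\le\beta_{\zeta,k}^{(p,q)}(2\phi;\eta)\,\beta_{\zeta,k}^{(p,q)}(2\psi;\eta).$$ Moreover, $\phi\mapsto\beta_{\zeta,k}^{(p,q)}(\phi;\eta)$ is convex on $(0,\infty)^n$.
   Context: $E_{n-1}=\{(t_1,\dots,t_{n-1})\in\mathbb{R}^{n-1}: t_i\ge 0,\ \sum_{i=1}^{n-1}t_i\le 1\}$; for $t\in E_{n-1}$ put $t_n=1-\sum_{i=1}^{n-1}t_i$, $dt=dt_1\cdots dt_{n-1}$. For $c>0$, $(c)_{0,k}=1$ and $(c)_{m,k}=c(c+k)\cdots(c+(m-1)k)$ for $m\ge1$. For scalars $a,b>0$, the confluent hypergeometric $k$-function is ${}_1F_{1,k}(a;b;x)=\sum_{m=0}^\infty \frac{(a)_{m,k}}{(b)_{m,k}}\frac{x^m}{m!}$, $x\in\mathbb{R}$. The generalized beta $k$-function of the second kind, for $\phi,p,q,\eta\in(0,\infty)^n$ and $\zeta\in[0,\infty)^n$, is $$\beta_{\zeta,k}^{(p,q)}(\phi;\eta)=\frac1{k^{n-1}}\int_{E_{n-1}}\prod_{i=1}^n \left[t_i^{\frac{\phi_i}{k}-1}\;{}_1F_{1,k}\!\left(p_i;q_i;-\frac{\eta_i^k}{kt_i}-\zeta_i^k\frac{t_i}{\eta_i^k}\right)\right]dt.$$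 *)

theory Defs
  imports "HOL-Analysis.Analysis"
begin

text \<open>
  Since both \<open>n\<close>- and \<open>(n-1)\<close>-dimensional vectors occur, an \<open>n\<close>-vector is a function
  \<open>nat \<Rightarrow> real\<close> of which only the values at \<open>1, \<dots>, n\<close> matter, and \<open>\<real>\<^sup>n\<^sup>-\<^sup>1\<close> with
  Lebesgue measure is the product space \<open>\<Pi>\<^sub>M i\<in>{1..<n}. lborel\<close>, whose points are
  functions extensional on \<open>{1..<n}\<close>.
\<close>

definition pochhammer_k :: "real \<Rightarrow> real \<Rightarrow> nat \<Rightarrow> real" where
  "pochhammer_k k c m = (\<Prod>j<m. c + real j * k)"

definition hyp1F1_k :: "real \<Rightarrow> real \<Rightarrow> real \<Rightarrow> real \<Rightarrow> real" where
  "hyp1F1_k k a b x = (\<Sum>m. pochhammer_k k a m / pochhammer_k k b m * (x ^ m / fact m))"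

definition simplex_E :: "nat \<Rightarrow> (nat \<Rightarrow> real) set" where
  "simplex_E n = {t \<in> {1..<n} \<rightarrow>\<^sub>E UNIV. (\<forall>i\<in>{1..<n}. 0 \<le> t i) \<and> (\<Sum>i\<in>{1..<n}. t i) \<le> 1}"

definition bary :: "nat \<Rightarrow> (nat \<Rightarrow> real) \<Rightarrow> nat \<Rightarrow> real" where
  "bary n t i = (if i = n then 1 - (\<Sum>j\<in>{1..<n}. t j) else t i)"

text \<open>
  On the null set where some \<open>t\<^sub>i = 0\<close> the integrand takes a conventional value
  (\<open>x / 0 = 0\<close>, \<open>0 powr a = 0\<close>). The base \<open>\<zeta> i\<close> may vanish; \<open>0 powr k = 0\<close> is then the
  intended value, as \<open>k > 0\<close>.
\<close>

definition gen_beta_k ::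
  "nat \<Rightarrow> real \<Rightarrow> (nat \<Rightarrow> real) \<Rightarrow> (nat \<Rightarrow> real) \<Rightarrow> (nat \<Rightarrow> real)
    \<Rightarrow> (nat \<Rightarrow> real) \<Rightarrow> (nat \<Rightarrow> real) \<Rightarrow> real" where
  "gen_beta_k n k \<zeta> p q \<phi> \<eta> =
    1 / k ^ (n - 1) *
    (LINT t : simplex_E n | (\<Pi>\<^sub>M i\<in>{1..<n}. lborel).
      (\<Prod>i\<in>{1..n}.
        bary n t i powr (\<phi> i / k - 1) *
        hyp1F1_k k (p i) (q i)
          (- (\<eta> i powr k) / (k * bary n t i)
           - \<zeta> i powr k * (bary n t i / \<eta> i powr k))))"

end

theory Submission
  imports Defs
begin

text \<open>
  The integrand depends on \<open>\<phi>\<close> only through \<open>\<Prod>\<^sub>i t\<^sub>i powr (\<phi>\<^sub>i / k - 1)\<close>, which is log-convex in \<open>\<phi>\<close>.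
  The first claim is therefore the Cauchy-Schwarz inequality, and the second follows from
  Young's inequality under the integral sign. Two facts make this work. The Kummer transformation
  \<open>F(a; b; -x) = exp (-x) * F(b - a; b; x)\<close> shows that the hypergeometric factors lie in \<open>[0, 1]\<close>.
  Hence the integrand is dominated by a Dirichlet density, which is integrable because it
  is an iterated convolution of powers on the positive half-line.
\<close>

section \<open>Pochhammer k-symbols and the Kummer transformation\<close>

lemma pochhammer_k_Suc: "pochhammer_k k c (Suc m) = pochhammer_k k c m * (c + real m * k)"
  by (simp add: pochhammer_k_def)

lemma pochhammer_k_rec: "pochhammer_k k c (Suc m) = c * pochhammer_k k (c + k) m"
  unfolding pochhammer_k_def prod.lessThan_Suc_shift by (simp add: algebra_simps)

lemma pochhammer_k_pos: "c > 0 \<Longrightarrow> k > 0 \<Longrightarrow> pochhammer_k k c m > 0"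
  unfolding pochhammer_k_def by (intro prod_pos) (auto intro: add_pos_nonneg)

lemma pochhammer_k_mono:
  assumes "0 < a" "a \<le> b" "k > 0"
  shows "pochhammer_k k a m \<le> pochhammer_k k b m"
  unfolding pochhammer_k_def using assms by (intro prod_mono) auto

text \<open>Chu-Vandermonde in k-form. Pascal's rule splits the sum at level \<open>m + 1\<close>
  into one at level \<open>m\<close> for (a, b) and one for (a + k, b + k). The shift preserves b -
  a, so both parts carry the same numerator; the induction must leave \<open>a\<close> and
  \<open>b\<close> arbitrary.\<close>

lemma alternating_pochhammer_k_sum:
  assumes "b > 0" "k > 0"
  shows "(\<Sum>j\<le>m. real (m choose j) * ((-1) ^ j * (pochhammer_k k a j / pochhammer_k k b j)))
       = pochhammer_k k (b - a) m / pochhammer_k k b m"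
  using assms
proof (induction m arbitrary: a b)
  case 0
  then show ?case by (simp add: pochhammer_k_def)
next
  case (Suc m)
  define c where "c = (\<lambda>j. (-1) ^ j * (pochhammer_k k a j / pochhammer_k k b j))"
  define d where "d = (\<lambda>j. (-1) ^ j * (pochhammer_k k (a + k) j / pochhammer_k k (b + k) j))"
  have cd: "c (Suc j) = - (a / b) * d j" for j
    unfolding c_def d_def by (simp add: pochhammer_k_rec)
  have "(\<Sum>j\<le>Suc m. real (Suc m choose j) * c j)
      = c 0 + (\<Sum>j\<le>m. real (Suc m choose Suc j) * c (Suc j))"
    by (subst sum.atMost_Suc_shift) simp
  also have "(\<Sum>j\<le>m. real (Suc m choose Suc j) * c (Suc j))
      = (\<Sum>j\<le>m. real (m choose Suc j) * c (Suc j)) + (\<Sum>j\<le>m. real (m choose j) * c (Suc j))"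
    by (simp add: sum.distrib[symmetric] algebra_simps)
  also have "c 0 + \<dots> = (\<Sum>j\<le>Suc m. real (m choose j) * c j)
      + (\<Sum>j\<le>m. real (m choose j) * c (Suc j))"
    by (subst sum.atMost_Suc_shift) simp
  \<comment> \<open>The last term drops out because \<open>m choose Suc m\<close> is 0.\<close>
  also have "(\<Sum>j\<le>Suc m. real (m choose j) * c j) = (\<Sum>j\<le>m. real (m choose j) * c j)"
    by simp
  also have "(\<Sum>j\<le>m. real (m choose j) * c (Suc j)) = - (a / b) * (\<Sum>j\<le>m. real (m choose j) * d j)"
    unfolding cd sum_distrib_left by (simp add: algebra_simps)
  also have "(\<Sum>j\<le>m. real (m choose j) * c j) = pochhammer_k k (b - a) m / pochhammer_k k b m"
    unfolding c_def using Suc.IH[OF Suc.prems] .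
  also have "(\<Sum>j\<le>m. real (m choose j) * d j) = pochhammer_k k (b - a) m / pochhammer_k k (b + k) m"
    unfolding d_def using Suc.IH[of "b + k" "a + k"] Suc.prems by simp
  also have "pochhammer_k k (b - a) m / pochhammer_k k b m
      + - (a / b) * (pochhammer_k k (b - a) m / pochhammer_k k (b + k) m)
      = pochhammer_k k (b - a) (Suc m) / pochhammer_k k b (Suc m)"
  proof -
    define P Q R where "P = pochhammer_k k (b - a) m" and "Q = pochhammer_k k b m"
      and "R = pochhammer_k k (b + k) m"
    have pos: "Q > 0" "R > 0" "b + real m * k > 0" "b > 0"
      unfolding Q_def R_def using Suc.prems by (auto intro!: pochhammer_k_pos add_pos_nonneg)
    \<comment> \<open>Both sides are \<open>pochhammer_k k b (Suc m)\<close>, split off at the first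
      and at the last factor. This yields the common denominator.\<close>
    have bR: "b * R = Q * (b + real m * k)"
      unfolding Q_def R_def using pochhammer_k_rec[of k b m] pochhammer_k_Suc[of k b m] by simp
    have "P / Q + - (a / b) * (P / R) = P / Q - a * P / (b * R)" by simp
    also have "\<dots> = P * (b - a + real m * k) / (Q * (b + real m * k))"
    proof -
      have "P / Q = P * (b + real m * k) / (Q * (b + real m * k))" using pos by simp
      then show ?thesis unfolding bR by (simp add: diff_divide_distrib[symmetric] algebra_simps)
    qed
    finally show ?thesis
      unfolding P_def Q_def R_def pochhammer_k_Suc .
  qed
  finally show ?case unfolding c_def .
qed

text \<open>For a \<le> b the quotients of Pochhammer symbols lie in [0, 1], so the exponential
  series is a majorant.\<close>

lemma hyp1F1_k_summable:
  assumes "0 < a" "a \<le> b" "k > 0"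
  shows "summable (\<lambda>m. norm (pochhammer_k k a m / pochhammer_k k b m * (x ^ m / fact m)))"
proof (rule summable_comparison_test)
  show "summable (\<lambda>m. norm (x ^ m /\<^sub>R fact m))"
    by (rule summable_norm_exp)
  have "pochhammer_k k a m / pochhammer_k k b m \<le> 1" "pochhammer_k k a m / pochhammer_k k b m \<ge> 0" for m
    using pochhammer_k_mono[OF assms, of m] pochhammer_k_pos[of a k m] pochhammer_k_pos[of b k m] assms
    by (auto simp: divide_simps)
  then have "norm (pochhammer_k k a m / pochhammer_k k b m * (x ^ m / fact m)) \<le> 1 * norm (x ^ m /\<^sub>R fact m)" for m
    unfolding norm_mult by (intro mult_mono) (simp_all add: abs_of_nonneg divide_inverse mult.commute)
  then show "\<exists>N. \<forall>m\<ge>N. norm (norm (pochhammer_k k a m / pochhammer_k k b m * (x ^ m / fact m)))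
      \<le> norm (x ^ m /\<^sub>R fact m)"
    by auto
qed

text \<open>In the Cauchy product of the series for F(a; b; -x) and exp x, the m-th coefficient is
  x^m / m! times the alternating binomial sum above. The product theorem also delivers convergence
  of the series for F(b - a; b; x), so a = b is covered.\<close>

lemma hyp1F1_k_Kummer:
  assumes "0 < a" "a \<le> b" "k > 0"
  shows "hyp1F1_k k a b (- x) = exp (- x) * hyp1F1_k k (b - a) b x"
proof -
  let ?A = "\<lambda>m. pochhammer_k k a m / pochhammer_k k b m * ((- x) ^ m / fact m)"
  let ?E = "\<lambda>m. x ^ m /\<^sub>R fact m"
  have "(\<lambda>m. \<Sum>i\<le>m. ?A i * ?E (m - i)) sums ((\<Sum>m. ?A m) * (\<Sum>m. ?E m))"
    by (intro Cauchy_product_sums hyp1F1_k_summable assms summable_norm_exp)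
  moreover have "(\<Sum>i\<le>m. ?A i * ?E (m - i))
      = pochhammer_k k (b - a) m / pochhammer_k k b m * (x ^ m / fact m)" for m
  proof -
    have "(\<Sum>i\<le>m. ?A i * ?E (m - i)) = (\<Sum>i\<le>m. x ^ m / fact m *
        (real (m choose i) * ((-1) ^ i * (pochhammer_k k a i / pochhammer_k k b i))))"
    proof (rule sum.cong[OF refl])
      fix i assume "i \<in> {..m}"
      then have i: "i \<le> m" by simp
      have "(- x) ^ i = (-1) ^ i * x ^ i" by (rule power_minus)
      moreover have "x ^ i * x ^ (m - i) = x ^ m"
        using i by (simp flip: power_add)
      moreover have "real (m choose i) = fact m / (fact i * fact (m - i))"
        by (rule binomial_fact[OF i])
      ultimately show "?A i * ?E (m - i) = x ^ m / fact m *
        (real (m choose i) * ((-1) ^ i * (pochhammer_k k a i / pochhammer_k k b i)))"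
        by (simp add: divide_inverse mult_ac)
    qed
    then show ?thesis
      unfolding sum_distrib_left[symmetric]
      using alternating_pochhammer_k_sum[of b k m a] assms by simp
  qed
  ultimately have "hyp1F1_k k (b - a) b x = hyp1F1_k k a b (- x) * exp x"
    unfolding hyp1F1_k_def exp_def by (simp add: sums_iff)
  then show ?thesis by (simp add: exp_minus)
qed

text \<open>The series alternates for x < 0, which hides both bounds. After Kummer, with y = -x, the
  terms are nonnegative and at most those of exp y, and the factor exp (-y) normalizes the bound to
  1.\<close>

lemma hyp1F1_k_nonpos_bounds:
  assumes "0 < a" "a < b" "k > 0" "x \<le> 0"
  shows "0 \<le> hyp1F1_k k a b x" and "hyp1F1_k k a b x \<le> 1"
proof -
  define y where "y = - x"
  have y: "y \<ge> 0" using assms by (simp add: y_def)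
  let ?c = "\<lambda>m. pochhammer_k k (b - a) m / pochhammer_k k b m"
  have c: "?c m \<ge> 0" "?c m \<le> 1" for m
    using pochhammer_k_mono[of "b - a" b k m] pochhammer_k_pos[of "b - a" k m]
      pochhammer_k_pos[of b k m] assms by (auto simp: divide_simps)
  have s: "summable (\<lambda>m. ?c m * (y ^ m / fact m))"
    using hyp1F1_k_summable[of "b - a" b k y] assms by (simp add: summable_norm_cancel)
  have e: "summable (\<lambda>m. y ^ m / fact m)" "exp y = (\<Sum>m. y ^ m / fact m)"
    using summable_norm_cancel[OF summable_norm_exp[of y]]
    unfolding exp_def by (simp_all add: divide_inverse_commute)
  have eq: "hyp1F1_k k a b x = exp (- y) * hyp1F1_k k (b - a) b y"
    using hyp1F1_k_Kummer[of a b k y] assms by (simp add: y_def)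
  have "hyp1F1_k k (b - a) b y \<ge> 0"
    unfolding hyp1F1_k_def
    by (intro suminf_nonneg s mult_nonneg_nonneg c divide_nonneg_nonneg zero_le_power y) simp
  then show "0 \<le> hyp1F1_k k a b x" unfolding eq by simp
  have "hyp1F1_k k (b - a) b y \<le> exp y"
    unfolding hyp1F1_k_def e(2)
    by (intro suminf_le s e mult_left_le_one_le c divide_nonneg_nonneg zero_le_power y) simp
  then show "hyp1F1_k k a b x \<le> 1"
    unfolding eq by (simp add: exp_minus field_simps)
qed

lemma borel_measurable_hyp1F1_k [measurable]: "hyp1F1_k k a b \<in> borel_measurable borel"
  unfolding hyp1F1_k_def [abs_def] by measurable

section \<open>Dirichlet integrals over the simplex\<close>

text \<open>
  Vanishing on the nonpositive reals builds the simplex constraints into the integrand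
  and makes these functions closed under convolution up to constants.
\<close>

definition pos_powr :: "real \<Rightarrow> real \<Rightarrow> real" where
  "pos_powr a x = (if 0 < x then x powr (a - 1) else 0)"

lemma pos_powr_nonneg [simp]: "0 \<le> pos_powr a x"
  by (simp add: pos_powr_def)

lemma borel_measurable_pos_powr [measurable]: "pos_powr a \<in> borel_measurable borel"
  unfolding pos_powr_def [abs_def] by measurable

text \<open>For s > 0 the substitution x = s * t reduces the claim to the Beta integral; the
  integrand contributes s to the power a + b - 2 and the Jacobian one more factor s. For s \<le> 0
  the arguments x and s - x are never both positive.\<close>

lemma nn_integral_pos_powr_convolution:
  assumes "a > 0" "b > 0"
  shows "(\<integral>\<^sup>+x. ennreal (pos_powr a x * pos_powr b (s - x)) \<partial>lborel)
       = ennreal (Beta a b * pos_powr (a + b) s)"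
proof (cases "s > 0")
  case False
  then have "pos_powr a x * pos_powr b (s - x) = 0" for x
    by (auto simp: pos_powr_def)
  then have "(\<integral>\<^sup>+x. ennreal (pos_powr a x * pos_powr b (s - x)) \<partial>lborel) = 0"
    by (simp only: ennreal_0) simp
  then show ?thesis using False by (simp add: pos_powr_def)
next
  case True
  have Beta: "((\<lambda>t. t powr (a - 1) * (1 - t) powr (b - 1)) has_integral Beta a b) {0..1}"
    using assms by (rule has_integral_Beta_real)
  have "Beta a b \<ge> 0"
    using has_integral_nonneg[OF Beta] by simp
  have scale: "pos_powr a (s * t) * pos_powr b (s - s * t) = s powr (a + b - 2) *
      (indicator {0..1} t * (t powr (a - 1) * (1 - t) powr (b - 1)))" for t
  proof (cases "0 < t \<and> t < 1")
    case inside: True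
    have "s - s * t = s * (1 - t)" by (simp add: algebra_simps)
    moreover have "s powr (a - 1) * s powr (b - 1) = s powr (a + b - 2)"
      by (simp add: powr_add[symmetric])
    ultimately show ?thesis
      using inside True by (simp add: pos_powr_def powr_mult)
  next
    \<comment> \<open>At t = 0 and t = 1 the indicator is 1, but the right-hand side still vanishes
      because \<open>0 powr _ = 0\<close>.\<close>
    case outside: False
    have "s * t < s \<longleftrightarrow> t < 1" using True by simp
    then show ?thesis
      using outside True
      by (auto simp: pos_powr_def zero_less_mult_iff indicator_def)
  qed
  have "(\<integral>\<^sup>+x. ennreal (pos_powr a x * pos_powr b (s - x)) \<partial>lborel)
      = s * (\<integral>\<^sup>+t. ennreal (pos_powr a (s * t) * pos_powr b (s - s * t)) \<partial>lborel)"
    using True by (subst nn_integral_real_affine[where c = s and t = 0]) auto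
  also have "(\<integral>\<^sup>+t. ennreal (pos_powr a (s * t) * pos_powr b (s - s * t)) \<partial>lborel)
     = ennreal (s powr (a + b - 2)) *
       (\<integral>\<^sup>+t. ennreal (indicator {0..1} t * (t powr (a - 1) * (1 - t) powr (b - 1))) \<partial>lborel)"
    unfolding scale by (simp add: ennreal_mult' nn_integral_cmult)
  also have "(\<integral>\<^sup>+t. ennreal (indicator {0..1} t * (t powr (a - 1) * (1 - t) powr (b - 1))) \<partial>lborel)
     = ennreal (Beta a b)"
    using Beta by (intro nn_integral_has_integral_lebesgue) auto
  also have "ennreal s * (ennreal (s powr (a + b - 2)) * ennreal (Beta a b))
     = ennreal (Beta a b * (s * s powr (a + b - 2)))"
    using True \<open>Beta a b \<ge> 0\<close> by (simp add: ennreal_mult'[symmetric] mult_ac)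
  also have "s * s powr (a + b - 2) = pos_powr (a + b) s"
    using True powr_add[of s 1 "a + b - 2"] by (simp add: pos_powr_def)
  finally show ?thesis .
qed

lemma product_sigma_finite_lborel: "product_sigma_finite (\<lambda>_. lborel :: real measure)"
  by standard

text \<open>Fixing one coordinate at x turns the remaining integral into the same one with s - x for
  s, so each induction step is a single convolution. This requires the claim for all s at once, with
  \<open>C\<close> independent of s.\<close>

lemma nn_integral_Dirichlet:
  fixes a :: "'i \<Rightarrow> real"
  assumes "finite I" "\<And>i. i \<in> I \<Longrightarrow> a i > 0" "b > 0"
  shows "\<exists>C\<ge>0. \<forall>s. (\<integral>\<^sup>+t. ennreal ((\<Prod>i\<in>I. pos_powr (a i) (t i)) * pos_powr b (s - (\<Sum>i\<in>I. t i)))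
            \<partial>(\<Pi>\<^sub>M i\<in>I. lborel)) = ennreal (C * pos_powr (b + (\<Sum>i\<in>I. a i)) s)"
  using assms(1,2)
proof (induction I)
  case empty
  interpret product_sigma_finite "\<lambda>_::'i. lborel :: real measure"
    by (rule product_sigma_finite_lborel)
  show ?case
    by (rule exI[of _ 1]) (simp add: nn_integral_count_space_finite PiM_empty)
next
  case (insert i I)
  interpret product_sigma_finite "\<lambda>_::'i. lborel :: real measure"
    by (rule product_sigma_finite_lborel)
  obtain C where "C \<ge> 0" and C:
    "\<And>s. (\<integral>\<^sup>+t. ennreal ((\<Prod>i\<in>I. pos_powr (a i) (t i)) * pos_powr b (s - (\<Sum>i\<in>I. t i)))
            \<partial>(\<Pi>\<^sub>M i\<in>I. lborel)) = ennreal (C * pos_powr (b + (\<Sum>i\<in>I. a i)) s)"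
    using insert by auto
  define c where "c = b + (\<Sum>i\<in>I. a i)"
  have "c > 0" unfolding c_def using insert.prems assms(3)
    by (intro add_pos_nonneg sum_nonneg less_imp_le) auto
  have "a i > 0" using insert.prems by simp
  have "Beta (a i) c \<ge> 0"
    using has_integral_nonneg[OF has_integral_Beta_real[OF \<open>a i > 0\<close> \<open>c > 0\<close>]] by simp
  let ?f = "\<lambda>s t. ennreal ((\<Prod>j\<in>insert i I. pos_powr (a j) (t j)) * pos_powr b (s - (\<Sum>j\<in>insert i I. t j)))"
  have "(\<integral>\<^sup>+t. ?f s t \<partial>(\<Pi>\<^sub>M j\<in>insert i I. lborel))
      = ennreal (C * Beta (a i) c * pos_powr (b + (\<Sum>j\<in>insert i I. a j)) s)" for s
  proof -
    have [measurable]: "(\<lambda>t. ?f s t) \<in> borel_measurable (\<Pi>\<^sub>M j\<in>insert i I. lborel)"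
      by measurable
    have upd: "?f s (t(i := x)) = ennreal (pos_powr (a i) x) *
        ennreal ((\<Prod>j\<in>I. pos_powr (a j) (t j)) * pos_powr b ((s - x) - (\<Sum>j\<in>I. t j)))" for t x
    proof -
      have "(\<Prod>j\<in>I. pos_powr (a j) ((t(i := x)) j)) = (\<Prod>j\<in>I. pos_powr (a j) (t j))"
        using insert.hyps by (intro prod.cong) auto
      moreover have "(\<Sum>j\<in>I. (t(i := x)) j) = (\<Sum>j\<in>I. t j)"
        using insert.hyps by (intro sum.cong) auto
      ultimately show ?thesis
        using insert.hyps by (simp add: ennreal_mult'[symmetric] algebra_simps)
    qed
    have "(\<integral>\<^sup>+t. ?f s t \<partial>(\<Pi>\<^sub>M j\<in>insert i I. lborel))
        = (\<integral>\<^sup>+x. (\<integral>\<^sup>+t. ?f s (t(i := x)) \<partial>(\<Pi>\<^sub>M j\<in>I. lborel)) \<partial>lborel)"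
      using insert.hyps by (intro product_nn_integral_insert_rev) auto
    also have "\<dots> = (\<integral>\<^sup>+x. ennreal (pos_powr (a i) x) * ennreal (C * pos_powr c (s - x)) \<partial>lborel)"
      unfolding upd by (subst nn_integral_cmult) (simp_all add: C c_def)
    also have "\<dots> = (\<integral>\<^sup>+x. ennreal C * ennreal (pos_powr (a i) x * pos_powr c (s - x)) \<partial>lborel)"
      using \<open>C \<ge> 0\<close> by (intro nn_integral_cong) (simp add: ennreal_mult'[symmetric] mult_ac)
    also have "\<dots> = ennreal C * ennreal (Beta (a i) c * pos_powr (a i + c) s)"
      using \<open>a i > 0\<close> \<open>c > 0\<close> by (simp add: nn_integral_cmult nn_integral_pos_powr_convolution)
    also have "\<dots> = ennreal (C * Beta (a i) c * pos_powr (b + (\<Sum>j\<in>insert i I. a j)) s)"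
      using insert.hyps \<open>C \<ge> 0\<close> by (simp add: ennreal_mult'[symmetric] c_def add_ac mult_ac)
    finally show ?thesis .
  qed
  then show ?case
    using \<open>C \<ge> 0\<close> \<open>Beta (a i) c \<ge> 0\<close> by (intro exI[of _ "C * Beta (a i) c"]) auto
qed

lemma measurable_bary [measurable]:
  assumes "i \<in> {1..n}"
  shows "(\<lambda>t. bary n t i) \<in> borel_measurable (\<Pi>\<^sub>M i\<in>{1..<n}. lborel)"
proof (cases "i = n")
  case True
  have "(\<lambda>t. bary n t i) = (\<lambda>t. 1 - (\<Sum>j\<in>{1..<n}. t j))"
    using True by (auto simp: bary_def)
  then show ?thesis by simp
next
  case False
  then have "(\<lambda>t. bary n t i) = (\<lambda>t. t i)" "i \<in> {1..<n}"
    using assms by (auto simp: bary_def)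
  then show ?thesis by (simp add: measurable_component_singleton)
qed

lemma sets_simplex_E [measurable]:
  "simplex_E n \<in> sets (\<Pi>\<^sub>M i\<in>{1..<n}. (lborel :: real measure))"
proof -
  have "simplex_E n = {t \<in> space (\<Pi>\<^sub>M i\<in>{1..<n}. (lborel :: real measure)).
      (\<forall>i\<in>{1..<n}. 0 \<le> t i) \<and> (\<Sum>i\<in>{1..<n}. t i) \<le> 1}"
    by (auto simp: simplex_E_def space_PiM)
  then show ?thesis by simp
qed

lemma bary_nonneg: "t \<in> simplex_E n \<Longrightarrow> i \<in> {1..n} \<Longrightarrow> 0 \<le> bary n t i"
  by (auto simp: simplex_E_def bary_def)

lemma integrable_Dirichlet:
  assumes "n \<ge> 1" "\<And>i. i \<in> {1..n} \<Longrightarrow> a i > 0"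
  shows "integrable (\<Pi>\<^sub>M i\<in>{1..<n}. lborel) (\<lambda>t. \<Prod>i\<in>{1..n}. pos_powr (a i) (bary n t i))"
proof (rule integrableI_bounded)
  show "(\<lambda>t. \<Prod>i\<in>{1..n}. pos_powr (a i) (bary n t i)) \<in> borel_measurable (\<Pi>\<^sub>M i\<in>{1..<n}. lborel)"
    by measurable
  obtain C where C: "\<And>s. (\<integral>\<^sup>+t. ennreal ((\<Prod>i\<in>{1..<n}. pos_powr (a i) (t i)) *
      pos_powr (a n) (s - (\<Sum>i\<in>{1..<n}. t i))) \<partial>(\<Pi>\<^sub>M i\<in>{1..<n}. lborel))
      = ennreal (C * pos_powr (a n + (\<Sum>i\<in>{1..<n}. a i)) s)"
    using nn_integral_Dirichlet[of "{1..<n}" a "a n"] assms by auto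
  have "{1..n} = insert n {1..<n}" using assms(1) by auto
  then have "(\<Prod>i\<in>{1..n}. pos_powr (a i) (bary n t i)) = (\<Prod>i\<in>{1..<n}. pos_powr (a i) (t i)) *
      pos_powr (a n) (1 - (\<Sum>i\<in>{1..<n}. t i))" for t
    by (simp add: bary_def mult.commute)
  then show "(\<integral>\<^sup>+t. ennreal (norm (\<Prod>i\<in>{1..n}. pos_powr (a i) (bary n t i)))
      \<partial>(\<Pi>\<^sub>M i\<in>{1..<n}. lborel)) < \<infinity>"
    using C[of 1] by (simp add: abs_mult abs_prod)
qed

section \<open>The integrand and the general inequalities behind both claims\<close>

definition beta_integrand ::
  "nat \<Rightarrow> real \<Rightarrow> (nat \<Rightarrow> real) \<Rightarrow> (nat \<Rightarrow> real) \<Rightarrow> (nat \<Rightarrow> real)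
    \<Rightarrow> (nat \<Rightarrow> real) \<Rightarrow> (nat \<Rightarrow> real) \<Rightarrow> (nat \<Rightarrow> real) \<Rightarrow> real" where
  "beta_integrand n k \<zeta> p q \<eta> \<phi> t = indicator (simplex_E n) t *
      (\<Prod>i\<in>{1..n}. bary n t i powr (\<phi> i / k - 1) *
        hyp1F1_k k (p i) (q i)
          (- (\<eta> i powr k) / (k * bary n t i) - \<zeta> i powr k * (bary n t i / \<eta> i powr k)))"

lemma gen_beta_k_eq_integral:
  "gen_beta_k n k \<zeta> p q \<phi> \<eta>
    = 1 / k ^ (n - 1) * (\<integral>t. beta_integrand n k \<zeta> p q \<eta> \<phi> t \<partial>(\<Pi>\<^sub>M i\<in>{1..<n}. lborel))"
  by (simp add: gen_beta_k_def beta_integrand_def set_lebesgue_integral_def)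

text \<open>For positive bases the left side is A^u * B^v, where A and B are the two products on the
  right, and Young's inequality applies.\<close>

lemma prod_powr_convex:
  fixes x :: "'i \<Rightarrow> real"
  assumes "finite I" "\<And>i. i \<in> I \<Longrightarrow> 0 \<le> x i" "0 \<le> u" "0 \<le> v" "u + v = 1"
  shows "(\<Prod>i\<in>I. x i powr (u * a i + v * b i))
    \<le> u * (\<Prod>i\<in>I. x i powr a i) + v * (\<Prod>i\<in>I. x i powr b i)"
proof (cases "\<forall>i\<in>I. 0 < x i")
  case True
  have "(\<Prod>i\<in>I. x i powr (u * a i + v * b i))
      = (\<Prod>i\<in>I. (x i powr a i) powr u * (x i powr b i) powr v)"
    by (simp add: powr_add powr_powr mult.commute)
  also have "\<dots> = (\<Prod>i\<in>I. x i powr a i) powr u * (\<Prod>i\<in>I. x i powr b i) powr v"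
    by (simp add: prod.distrib prod_powr_distrib)
  also have "\<dots> \<le> u * (\<Prod>i\<in>I. x i powr a i) + v * (\<Prod>i\<in>I. x i powr b i)"
    using assms True by (intro Youngs_inequality_0 prod_pos) auto
  finally show ?thesis .
next
  case False
  \<comment> \<open>A zero base annihilates the left product whatever its exponent, by
    \<open>0 powr _ = 0\<close>.\<close>
  then obtain i where "i \<in> I" "x i = 0" using assms(2) by force
  then have "(\<Prod>i\<in>I. x i powr (u * a i + v * b i)) = 0"
    using assms(1) by (intro prod_zero) auto
  moreover have "0 \<le> u * (\<Prod>i\<in>I. x i powr a i) + v * (\<Prod>i\<in>I. x i powr b i)"
    using assms by (intro add_nonneg_nonneg mult_nonneg_nonneg prod_nonneg) auto
  ultimately show ?thesis by simp
qed

text \<open>Discriminant argument: integrating a pointwise nonnegative quadratic in c gives a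
  quadratic with coefficients B, -2A and D that is nonnegative for all c.\<close>

lemma integral_Cauchy_Schwarz:
  fixes f g h :: "'a \<Rightarrow> real"
  assumes "integrable M f" "integrable M g" "integrable M h"
    and "\<And>x. 0 \<le> g x" "\<And>x. 0 \<le> h x" "\<And>x. (f x)\<^sup>2 = g x * h x"
  shows "(\<integral>x. f x \<partial>M)\<^sup>2 \<le> (\<integral>x. g x \<partial>M) * (\<integral>x. h x \<partial>M)"
proof -
  define A B D where "A = (\<integral>x. f x \<partial>M)" and "B = (\<integral>x. g x \<partial>M)" and "D = (\<integral>x. h x \<partial>M)"
  have B: "B \<ge> 0" unfolding B_def using assms by simp
  have quadratic: "0 \<le> c\<^sup>2 * B - 2 * c * A + D" for c
  proof -
    have "0 \<le> c\<^sup>2 * g x - 2 * c * f x + h x" for x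
    proof -
      \<comment> \<open>Since only the square of f is known, its sign may vary with x; either sign
        makes the quadratic a perfect square.\<close>
      have "f x = sqrt (g x) * sqrt (h x) \<or> f x = - (sqrt (g x) * sqrt (h x))"
        using assms(6)[of x] assms(4,5)[of x] by (metis power2_eq_iff power_mult_distrib real_sqrt_pow2)
      moreover have "0 \<le> (c * sqrt (g x) - sqrt (h x))\<^sup>2" "0 \<le> (c * sqrt (g x) + sqrt (h x))\<^sup>2" by auto
      ultimately show ?thesis
        using assms(4,5)[of x] by (auto simp: power2_diff power2_sum power_mult_distrib algebra_simps)
    qed
    then have "0 \<le> (\<integral>x. c\<^sup>2 * g x - 2 * c * f x + h x \<partial>M)" by simp
    also have "\<dots> = c\<^sup>2 * B - 2 * c * A + D"
      unfolding A_def B_def D_def using assms by simp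
    finally show ?thesis .
  qed
  have "A\<^sup>2 \<le> B * D"
  proof (cases "B = 0")
    case True
    then have "A = 0"
      \<comment> \<open>For B = 0 the quadratic is D - 2 * c * A, and this c would give it the value
        -1.\<close>
      using quadratic[of "(D + 1) / (2 * A)"] by (cases "A = 0") auto
    then show ?thesis using True by simp
  next
    case False
    with B have "B > 0" by simp
    then show ?thesis
      \<comment> \<open>The minimum is attained at c = A / B, with value D - A^2 / B.\<close>
      using quadratic[of "A / B"] by (simp add: field_simps power2_eq_square)
  qed
  then show ?thesis unfolding A_def B_def D_def .
qed

section \<open>Bounds and integrability of the integrand, and the two inequalities\<close>

context
  fixes n :: nat and k :: real and \<eta> p q \<zeta> :: "nat \<Rightarrow> real"
  assumes n: "n \<ge> 1" and k: "k > 0"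
    and p: "\<And>i. i \<in> {1..n} \<Longrightarrow> 0 < p i" and q: "\<And>i. i \<in> {1..n} \<Longrightarrow> p i < q i"
begin

text \<open>The part of the integrand free of \<phi>, split off so that only a product of powers has
  to be compared.\<close>

definition hyp_factor :: "(nat \<Rightarrow> real) \<Rightarrow> real" where
  "hyp_factor t = (\<Prod>i\<in>{1..n}. hyp1F1_k k (p i) (q i)
          (- (\<eta> i powr k) / (k * bary n t i) - \<zeta> i powr k * (bary n t i / \<eta> i powr k)))"

lemma beta_integrand_eq:
  "beta_integrand n k \<zeta> p q \<eta> \<phi> t = indicator (simplex_E n) t *
     (hyp_factor t * (\<Prod>i\<in>{1..n}. bary n t i powr (\<phi> i / k - 1)))"
  by (simp add: beta_integrand_def hyp_factor_def prod.distrib)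

text \<open>On the simplex every hypergeometric argument is nonpositive. This persists where a
  coordinate is 0, as division by zero yields 0.\<close>

lemma hyp_factor_bounds:
  assumes "t \<in> simplex_E n"
  shows "0 \<le> hyp_factor t" "hyp_factor t \<le> 1"
proof -
  let ?x = "\<lambda>i. - (\<eta> i powr k) / (k * bary n t i) - \<zeta> i powr k * (bary n t i / \<eta> i powr k)"
  have "?x i \<le> 0" if "i \<in> {1..n}" for i
  proof -
    have "0 \<le> \<eta> i powr k / (k * bary n t i)" "0 \<le> \<zeta> i powr k * (bary n t i / \<eta> i powr k)"
      using bary_nonneg[OF assms that] k by auto
    then show ?thesis by simp
  qed
  then have "0 \<le> hyp1F1_k k (p i) (q i) (?x i) \<and> hyp1F1_k k (p i) (q i) (?x i) \<le> 1"
    if "i \<in> {1..n}" for i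
    using hyp1F1_k_nonpos_bounds[of "p i" "q i" k "?x i"] p q k that by blast
  then show "0 \<le> hyp_factor t" "hyp_factor t \<le> 1"
    unfolding hyp_factor_def by (auto intro!: prod_nonneg prod_le_1)
qed

lemma beta_integrand_nonneg: "0 \<le> beta_integrand n k \<zeta> p q \<eta> \<phi> t"
  unfolding beta_integrand_eq
  by (cases "t \<in> simplex_E n") (auto intro!: mult_nonneg_nonneg hyp_factor_bounds prod_nonneg)

lemma integrable_beta_integrand:
  assumes "\<And>i. i \<in> {1..n} \<Longrightarrow> \<phi> i > 0"
  shows "integrable (\<Pi>\<^sub>M i\<in>{1..<n}. lborel) (beta_integrand n k \<zeta> p q \<eta> \<phi>)"
proof (rule Bochner_Integration.integrable_bound)
  show "integrable (\<Pi>\<^sub>M i\<in>{1..<n}. lborel) (\<lambda>t. \<Prod>i\<in>{1..n}. pos_powr (\<phi> i / k) (bary n t i))"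
    using n k assms by (intro integrable_Dirichlet) auto
  show "beta_integrand n k \<zeta> p q \<eta> \<phi> \<in> borel_measurable (\<Pi>\<^sub>M i\<in>{1..<n}. lborel)"
    unfolding beta_integrand_def [abs_def] by measurable
  have "beta_integrand n k \<zeta> p q \<eta> \<phi> t \<le> (\<Prod>i\<in>{1..n}. pos_powr (\<phi> i / k) (bary n t i))" for t
  proof (cases "t \<in> simplex_E n")
    case True
    \<comment> \<open>\<open>powr\<close> and \<open>pos_powr\<close> agree at nonnegative
      arguments, both being 0 at 0.\<close>
    have "(\<Prod>i\<in>{1..n}. bary n t i powr (\<phi> i / k - 1)) = (\<Prod>i\<in>{1..n}. pos_powr (\<phi> i / k) (bary n t i))"
      using bary_nonneg[OF True] by (intro prod.cong) (force simp: pos_powr_def)+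
    then show ?thesis
      using True hyp_factor_bounds[OF True]
      by (auto simp: beta_integrand_eq intro!: mult_left_le_one_le prod_nonneg)
  qed (auto simp: beta_integrand_eq intro!: prod_nonneg)
  then show "AE t in (\<Pi>\<^sub>M i\<in>{1..<n}. lborel). norm (beta_integrand n k \<zeta> p q \<eta> \<phi> t)
      \<le> norm (\<Prod>i\<in>{1..n}. pos_powr (\<phi> i / k) (bary n t i))"
    using beta_integrand_nonneg by (auto simp: abs_prod)
qed

text \<open>Supplies the equality hypothesis of Cauchy-Schwarz: the exponents of the two factors add
  up to twice the exponent for \<phi> + \<psi>, and the indicator is idempotent.\<close>

lemma beta_integrand_midpoint:
  "(beta_integrand n k \<zeta> p q \<eta> (\<lambda>i. \<phi> i + \<psi> i) t)\<^sup>2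
    = beta_integrand n k \<zeta> p q \<eta> (\<lambda>i. 2 * \<phi> i) t * beta_integrand n k \<zeta> p q \<eta> (\<lambda>i. 2 * \<psi> i) t"
proof -
  have "(x powr ((\<phi> i + \<psi> i) / k - 1))\<^sup>2 = x powr (2 * \<phi> i / k - 1) * x powr (2 * \<psi> i / k - 1)"
    for x i
    by (simp add: power2_eq_square powr_add[symmetric] add_divide_distrib algebra_simps)
  then show ?thesis
    by (simp add: beta_integrand_eq power_mult_distrib prod_power_distrib prod.distrib
        power2_eq_square[of "hyp_factor t"] indicator_def)
qed

lemma beta_integrand_convex:
  assumes "0 \<le> u" "0 \<le> v" "u + v = 1"
  shows "beta_integrand n k \<zeta> p q \<eta> (\<lambda>i. u * \<phi> i + v * \<psi> i) t
    \<le> u * beta_integrand n k \<zeta> p q \<eta> \<phi> t + v * beta_integrand n k \<zeta> p q \<eta> \<psi> t"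
proof (cases "t \<in> simplex_E n")
  case True
  \<comment> \<open>The constant -1 splits as -u - v because u + v = 1.\<close>
  have "(u * \<phi> i + v * \<psi> i) / k - 1 = u * (\<phi> i / k - 1) + v * (\<psi> i / k - 1)" for i
    using assms(3) by (simp add: algebra_simps add_divide_distrib)
  then have "(\<Prod>i\<in>{1..n}. bary n t i powr ((u * \<phi> i + v * \<psi> i) / k - 1))
    \<le> u * (\<Prod>i\<in>{1..n}. bary n t i powr (\<phi> i / k - 1))
      + v * (\<Prod>i\<in>{1..n}. bary n t i powr (\<psi> i / k - 1))"
    using prod_powr_convex[of "{1..n}" "bary n t" u v] bary_nonneg[OF True] assms by simp
  from mult_left_mono[OF this hyp_factor_bounds(1)[OF True]]
  show ?thesis using True by (simp add: beta_integrand_eq algebra_simps)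
qed (simp add: beta_integrand_eq)

lemma gen_beta_k_log_convex:
  assumes "\<And>i. i \<in> {1..n} \<Longrightarrow> \<phi> i > 0" "\<And>i. i \<in> {1..n} \<Longrightarrow> \<psi> i > 0"
  shows "(gen_beta_k n k \<zeta> p q (\<lambda>i. \<phi> i + \<psi> i) \<eta>)\<^sup>2
    \<le> gen_beta_k n k \<zeta> p q (\<lambda>i. 2 * \<phi> i) \<eta> * gen_beta_k n k \<zeta> p q (\<lambda>i. 2 * \<psi> i) \<eta>"
proof -
  let ?I = "\<lambda>\<phi>. \<integral>t. beta_integrand n k \<zeta> p q \<eta> \<phi> t \<partial>(\<Pi>\<^sub>M i\<in>{1..<n}. lborel)"
  have "(?I (\<lambda>i. \<phi> i + \<psi> i))\<^sup>2 \<le> ?I (\<lambda>i. 2 * \<phi> i) * ?I (\<lambda>i. 2 * \<psi> i)"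
    using assms by (intro integral_Cauchy_Schwarz integrable_beta_integrand beta_integrand_nonneg
        beta_integrand_midpoint) (auto intro: add_pos_pos)
  \<comment> \<open>The normalizing factor enters squared on both sides.\<close>
  from mult_left_mono[OF this, of "(1 / k ^ (n - 1))\<^sup>2"]
  show ?thesis
    unfolding gen_beta_k_eq_integral by (simp add: power2_eq_square mult_ac)
qed

lemma gen_beta_k_convex:
  assumes "\<And>i. i \<in> {1..n} \<Longrightarrow> \<phi> i > 0" "\<And>i. i \<in> {1..n} \<Longrightarrow> \<psi> i > 0"
    and "0 \<le> u" "0 \<le> v" "u + v = 1"
  shows "gen_beta_k n k \<zeta> p q (\<lambda>i. u * \<phi> i + v * \<psi> i) \<eta>
    \<le> u * gen_beta_k n k \<zeta> p q \<phi> \<eta> + v * gen_beta_k n k \<zeta> p q \<psi> \<eta>"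
proof -
  let ?M = "\<Pi>\<^sub>M i\<in>{1..<n}. (lborel :: real measure)"
  let ?f = "beta_integrand n k \<zeta> p q \<eta>"
  \<comment> \<open>At least one weight is positive, so the combination stays in the open orthant,
    where the integrand is integrable.\<close>
  have comb: "u * \<phi> i + v * \<psi> i > 0" if "i \<in> {1..n}" for i
    using assms(1,2)[OF that] assms(3-5)
    by (cases "u = 0") (auto intro!: add_pos_nonneg mult_pos_pos mult_nonneg_nonneg)
  note int = integrable_beta_integrand[OF assms(1)] integrable_beta_integrand[OF assms(2)]
  have "(\<integral>t. ?f (\<lambda>i. u * \<phi> i + v * \<psi> i) t \<partial>?M) \<le> (\<integral>t. u * ?f \<phi> t + v * ?f \<psi> t \<partial>?M)"
    using assms comb by (intro integral_mono Bochner_Integration.integrable_add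
        integrable_mult_right integrable_beta_integrand beta_integrand_convex)
  also have "\<dots> = u * (\<integral>t. ?f \<phi> t \<partial>?M) + v * (\<integral>t. ?f \<psi> t \<partial>?M)"
    using int by (subst Bochner_Integration.integral_add) (simp_all del: One_nat_def)
  finally have le: "(\<integral>t. ?f (\<lambda>i. u * \<phi> i + v * \<psi> i) t \<partial>?M)
      \<le> u * (\<integral>t. ?f \<phi> t \<partial>?M) + v * (\<integral>t. ?f \<psi> t \<partial>?M)" .
  show ?thesis
    using mult_left_mono[OF le, of "1 / k ^ (n - 1)"] k
    unfolding gen_beta_k_eq_integral by (simp add: algebra_simps)
qed

end

theorem theorem2p6:
  fixes n :: nat and k :: real and \<eta> p q \<zeta> :: "nat \<Rightarrow> real"
  assumes "n \<ge> 2" and "k > 0"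
    and "\<eta> \<in> {1..n} \<rightarrow> {0<..}"
    and "p \<in> {1..n} \<rightarrow> {0<..}"
    and "(\<lambda>i. q i - p i) \<in> {1..n} \<rightarrow> {0<..}"
    and "\<zeta> \<in> {1..n} \<rightarrow> {0..}"
  shows "(\<forall>\<phi> \<in> {1..n} \<rightarrow> {0<..}. \<forall>\<psi> \<in> {1..n} \<rightarrow> {0<..}.
            (gen_beta_k n k \<zeta> p q (\<lambda>i. \<phi> i + \<psi> i) \<eta>)\<^sup>2
              \<le> gen_beta_k n k \<zeta> p q (\<lambda>i. 2 * \<phi> i) \<eta> * gen_beta_k n k \<zeta> p q (\<lambda>i. 2 * \<psi> i) \<eta>)
       \<and> (\<forall>\<phi> \<in> {1..n} \<rightarrow> {0<..}. \<forall>\<psi> \<in> {1..n} \<rightarrow> {0<..}. \<forall>u\<ge>0. \<forall>v\<ge>0. u + v = 1 \<longrightarrow>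
            gen_beta_k n k \<zeta> p q (\<lambda>i. u * \<phi> i + v * \<psi> i) \<eta>
              \<le> u * gen_beta_k n k \<zeta> p q \<phi> \<eta> + v * gen_beta_k n k \<zeta> p q \<psi> \<eta>)"
proof (intro conjI ballI allI impI)
  have pq: "\<And>i. i \<in> {1..n} \<Longrightarrow> 0 < p i" "\<And>i. i \<in> {1..n} \<Longrightarrow> p i < q i"
    using assms(4,5) by (auto simp: Pi_iff)
  have n: "n \<ge> 1" using assms(1) by simp
  fix \<phi> \<psi> :: "nat \<Rightarrow> real"
  assume "\<phi> \<in> {1..n} \<rightarrow> {0<..}" "\<psi> \<in> {1..n} \<rightarrow> {0<..}"
  then have pos: "\<And>i. i \<in> {1..n} \<Longrightarrow> \<phi> i > 0" "\<And>i. i \<in> {1..n} \<Longrightarrow> \<psi> i > 0"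
    by (auto simp: Pi_iff)
  show "(gen_beta_k n k \<zeta> p q (\<lambda>i. \<phi> i + \<psi> i) \<eta>)\<^sup>2
      \<le> gen_beta_k n k \<zeta> p q (\<lambda>i. 2 * \<phi> i) \<eta> * gen_beta_k n k \<zeta> p q (\<lambda>i. 2 * \<psi> i) \<eta>"
    by (rule gen_beta_k_log_convex[OF n assms(2) pq pos])
  show "gen_beta_k n k \<zeta> p q (\<lambda>i. u * \<phi> i + v * \<psi> i) \<eta>
      \<le> u * gen_beta_k n k \<zeta> p q \<phi> \<eta> + v * gen_beta_k n k \<zeta> p q \<psi> \<eta>"
    if "0 \<le> u" "0 \<le> v" "u + v = 1" for u v
    by (rule gen_beta_k_convex[OF n assms(2) pq pos that])
qed

end
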